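(* Let $(\mathfrak{g},\langle\,,\rangle)$ be a flat pseudo-Euclidean nilpotent Lie algebra of signature $(2,n-2)$, where $n=\dim\mathfrak{g}$. Then, for any $e\in Z(\mathfrak{g})\cap Z(\mathfrak{g})^\perp$, $\mathrm{L}_e=\mathrm{R}_e=0$. Moreover, $Z(\mathfrak{g})+Z(\mathfrak{g})^\perp$ is a two-sided ideal with respect to the Levi-Civita product.
   Context: A pseudo-Euclidean Lie algebra $(\mathfrak{g},\langle\,,\rangle)$ is a finite-dimensional real Lie algebra with a non-degenerate symmetric bilinear form. Its Levi-Civita product $(u,v)\mapsto u.v$ is defined by $2\langle u.v,w\rangle=\langle[u,v],w\rangle+\langle[w,u],v\rangle+\langle[w,v],u\rangle$ for all $u,v,w\in\mathfrak{g}$. Write $\mathrm{L}_u v=u.v$ and $\mathrm{R}_uv=v.u$. $(\mathfrak{g},\langle\,,\rangle)$ is flat if the Levi-Civita product is left symmetric: $(u.v).w-u.(v.w)=(v.u).w-v.(u.w)$ for all $u,v,w$; equivalently $\mathrm{L}_{[u,v]}=[\mathrm{L}_u,\mathrm{L}_v]$. Signature $(p,q)$ means $p$ negative and $q$ positive directions. $Z(\mathfrak{g})$ is the center and $\perp$ denotes the orthogonal with respect to $\langle\,,\rangle$. A subspace $I$ is a two-sided ideal for the product if $u.a\in I$ and $a.u\in I$ for all $u\in\mathfrak{g}$, $a\in I$. *)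

theory Defs
  imports "HOL-Analysis.Analysis" "HOL-Library.Set_Algebras"
begin

text \<open>
  The underlying vector space is a whole type of class \<^class>\<open>real_vector\<close>, with finite
  dimension assumed explicitly.  The class \<^class>\<open>euclidean_space\<close> is avoided because it
  would carry an unrelated positive definite inner product.
\<close>

locale real_lie_algebra =
  fixes br :: "'a::real_vector \<Rightarrow> 'a \<Rightarrow> 'a"
  assumes bilinear_br: "bilinear br"
    and br_self: "br x x = 0"
    and jacobi: "br x (br y z) + br y (br z x) + br z (br x y) = 0"

locale pseudo_euclidean_lie_algebra = real_lie_algebra br
  for br :: "'a::real_vector \<Rightarrow> 'a \<Rightarrow> 'a" +
  fixes B :: "'a \<Rightarrow> 'a \<Rightarrow> real"
  assumes finite_dim: "\<exists>S::'a set. finite S \<and> span S = UNIV"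
    and bilinear_form: "bilinear B"
    and form_sym: "B x y = B y x"
    and form_nondegenerate: "(\<And>y. B x y = 0) \<Longrightarrow> x = 0"

text \<open>\<open>p\<close> negative and \<open>q\<close> positive directions in an orthonormal basis.\<close>

definition has_signature :: "('a::real_vector \<Rightarrow> 'a \<Rightarrow> real) \<Rightarrow> nat \<Rightarrow> nat \<Rightarrow> bool" where
  "has_signature B p q \<longleftrightarrow>
    (\<exists>N P. finite N \<and> finite P \<and> N \<inter> P = {} \<and> card N = p \<and> card P = q \<and>
      independent (N \<union> P) \<and> span (N \<union> P) = UNIV \<and>
      (\<forall>x\<in>N. B x x = -1) \<and> (\<forall>x\<in>P. B x x = 1) \<and>
      (\<forall>x\<in>N \<union> P. \<forall>y\<in>N \<union> P. x \<noteq> y \<longrightarrow> B x y = 0))"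

primrec lower_central_series :: "('a::real_vector \<Rightarrow> 'a \<Rightarrow> 'a) \<Rightarrow> nat \<Rightarrow> 'a set" where
  "lower_central_series br 0 = UNIV"
| "lower_central_series br (Suc k) = span {br x y | x y. y \<in> lower_central_series br k}"

definition nilpotent_bracket :: "('a::real_vector \<Rightarrow> 'a \<Rightarrow> 'a) \<Rightarrow> bool" where
  "nilpotent_bracket br \<longleftrightarrow> (\<exists>k. lower_central_series br k = {0})"

definition lie_center :: "('a::real_vector \<Rightarrow> 'a \<Rightarrow> 'a) \<Rightarrow> 'a set" where
  "lie_center br = {z. \<forall>x. br z x = 0}"

definition form_perp :: "('a::real_vector \<Rightarrow> 'a \<Rightarrow> real) \<Rightarrow> 'a set \<Rightarrow> 'a set" where
  "form_perp B S = {x. \<forall>y\<in>S. B x y = 0}"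

text \<open>
  The description below determines a unique vector as soon as \<open>B\<close> is non-degenerate on a
  finite-dimensional space; see \<open>levi_civita_eq\<close> and \<open>levi_civita_unique\<close>.
\<close>

definition levi_civita ::
  "('a::real_vector \<Rightarrow> 'a \<Rightarrow> 'a) \<Rightarrow> ('a \<Rightarrow> 'a \<Rightarrow> real) \<Rightarrow> 'a \<Rightarrow> 'a \<Rightarrow> 'a" where
  "levi_civita br B u v =
    (THE x. \<forall>w. 2 * B x w = B (br u v) w + B (br w u) v + B (br w v) u)"

definition left_mult ::
  "('a::real_vector \<Rightarrow> 'a \<Rightarrow> 'a) \<Rightarrow> ('a \<Rightarrow> 'a \<Rightarrow> real) \<Rightarrow> 'a \<Rightarrow> 'a \<Rightarrow> 'a" where
  "left_mult br B u = (\<lambda>v. levi_civita br B u v)"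

definition right_mult ::
  "('a::real_vector \<Rightarrow> 'a \<Rightarrow> 'a) \<Rightarrow> ('a \<Rightarrow> 'a \<Rightarrow> real) \<Rightarrow> 'a \<Rightarrow> 'a \<Rightarrow> 'a" where
  "right_mult br B u = (\<lambda>v. levi_civita br B v u)"

definition left_symmetric :: "('a::real_vector \<Rightarrow> 'a \<Rightarrow> 'a) \<Rightarrow> bool" where
  "left_symmetric m \<longleftrightarrow>
    (\<forall>u v w. m (m u v) w - m u (m v w) = m (m v u) w - m v (m u w))"

definition flat :: "('a::real_vector \<Rightarrow> 'a \<Rightarrow> 'a) \<Rightarrow> ('a \<Rightarrow> 'a \<Rightarrow> real) \<Rightarrow> bool" where
  "flat br B \<longleftrightarrow> left_symmetric (levi_civita br B)"

definition two_sided_ideal :: "('a::real_vector \<Rightarrow> 'a \<Rightarrow> 'a) \<Rightarrow> 'a set \<Rightarrow> bool" where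
  "two_sided_ideal m I \<longleftrightarrow> subspace I \<and> (\<forall>u. \<forall>a\<in>I. m u a \<in> I \<and> m a u \<in> I)"

context pseudo_euclidean_lie_algebra
begin

lemma form_represents:
  assumes f: "linear (f :: 'a \<Rightarrow> real)"
  shows "\<exists>x. \<forall>w. B x w = f w"
proof -
  obtain S0 :: "'a set" where S0: "finite S0" "span S0 = UNIV"
    using finite_dim by blast
  obtain S where S: "S \<subseteq> S0" "independent S" "span S = UNIV"
    using maximal_independent_subset[of S0] S0 span_mono span_span
    by (metis span_minimal subspace_span top.extremum_uniqueI)
  have fin: "finite S" using S S0 finite_subset by blast
  interpret fd: finite_dimensional_vector_space "scaleR :: real \<Rightarrow> 'a \<Rightarrow> 'a" S
    using fin S
    by unfold_locales (auto simp: dependent_raw_def span_raw_def scaleR_right_distrib scaleR_left_distrib)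
  have linB: "linear (B x)" "linear (\<lambda>y. B y x)" for x
    using bilinear_form by (auto simp: bilinear_def)
  define T where "T = (\<lambda>x. \<Sum>b\<in>S. B x b *\<^sub>R b)"
  have linT: "linear T"
    unfolding T_def
    by (intro linearI) (simp_all add: linear_add[OF linB(2)] linear_scale[OF linB(2)]
        scaleR_left_distrib sum.distrib scaleR_sum_right)
  have agree: "g = h" if "linear g" "linear h" "\<And>b. b \<in> S \<Longrightarrow> g b = h b" for g h :: "'a \<Rightarrow> real"
    using linear_eq_on_span[OF that(1,2), of S] that(3) S(3) by auto
  have coeff: "c b = d b" if "(\<Sum>b\<in>S. c b *\<^sub>R b) = (\<Sum>b\<in>S. d b *\<^sub>R b)" "b \<in> S" for c d b
  proof -
    have "(\<Sum>b\<in>S. (c b - d b) *\<^sub>R b) = 0"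
      using that(1) by (simp add: scaleR_left_diff_distrib sum_subtractf)
    then show ?thesis
      using independentD[OF S(2) fin order_refl, of "\<lambda>b. c b - d b"] that(2) by simp
  qed
  have "x = y" if "T x = T y" for x y
  proof -
    have "B x = B y"
      by (rule agree[OF linB(1) linB(1)]) (rule coeff[OF that[unfolded T_def]])
    then have "B (x - y) w = 0" for w
      by (simp add: linear_diff[OF linB(2)])
    then show ?thesis using form_nondegenerate[of "x - y"] by simp
  qed
  then have "inj T" by (auto intro: injI)
  then have "surj T"
    using fd.linear_inj_imp_surj linT by (simp add: linear_def)
  then obtain x where x: "T x = (\<Sum>b\<in>S. f b *\<^sub>R b)"
    by (metis surjD)
  have "B x = f"
    by (rule agree[OF linB(1) f]) (rule coeff[OF x[unfolded T_def]])
  then show ?thesis by auto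
qed

lemma form_eqI: "x = y" if "\<And>w. B x w = B y w"
  using that form_nondegenerate[of "x - y"] bilinear_lsub[OF bilinear_form] by simp

lemma levi_civita_unique:
  assumes "\<And>w. 2 * B x w = B (br u v) w + B (br w u) v + B (br w v) u"
  shows "levi_civita br B u v = x"
  unfolding levi_civita_def
proof (rule the_equality)
  show "\<forall>w. 2 * B x w = B (br u v) w + B (br w u) v + B (br w v) u"
    using assms by blast
next
  fix y assume y: "\<forall>w. 2 * B y w = B (br u v) w + B (br w u) v + B (br w v) u"
  show "y = x"
  proof (rule form_eqI)
    fix w
    have "2 * B y w = 2 * B x w" using y assms by simp
    then show "B y w = B x w" by simp
  qed
qed

lemma levi_civita_eq:
  "2 * B (levi_civita br B u v) w = B (br u v) w + B (br w u) v + B (br w v) u"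
proof -
  have "linear (\<lambda>w. (B (br u v) w + B (br w u) v + B (br w v) u) / 2)"
    by (intro linearI)
      (simp_all add: bilinear_ladd[OF bilinear_form] bilinear_radd[OF bilinear_form]
        bilinear_lmul[OF bilinear_form] bilinear_rmul[OF bilinear_form]
        bilinear_ladd[OF bilinear_br] bilinear_lmul[OF bilinear_br] algebra_simps add_divide_distrib)
  from form_represents[OF this] obtain x
    where x: "\<And>w. B x w = (B (br u v) w + B (br w u) v + B (br w v) u) / 2"
    by blast
  have "levi_civita br B u v = x"
    by (rule levi_civita_unique) (simp add: x)
  then show ?thesis by (simp add: x)
qed

end

end

theory Submission
  imports Defs
begin

text \<open>
  Write \<open>u \<star> v\<close> for the Levi-Civita product; \<open>L\<^sub>u\<close> is skew-symmetric and
  \<open>u \<star> v - v \<star> u = [u, v]\<close>.  Let \<open>z\<close> be central.  Then \<open>L\<^sub>z = R\<^sub>z\<close> and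
  \<open>z \<star> z = 0\<close>, and left symmetry applied to \<open>(w, z, z)\<close> collapses to \<open>L\<^sub>z\<^sup>2 = 0\<close>
  (\<open>central_mult_square\<close>).  By skew-symmetry the image of \<open>L\<^sub>z\<close> is totally isotropic, and it
  is orthogonal to \<open>z\<close>.

  Let moreover \<open>e\<close> be central and isotropic, as is every element of \<open>Z \<inter> Z\<^sup>\<bottom>\<close>, and suppose
  \<open>L\<^sub>e \<noteq> 0\<close>.  A non-zero skew-symmetric map has rank at least two, so the image of \<open>L\<^sub>e\<close>
  contains two independent vectors; together with \<open>e\<close> they span a totally isotropic subspace.
  With only two negative directions such a subspace is at most two-dimensional
  (\<open>isotropic_card_le\<close>), so \<open>e\<close> lies in the image: \<open>e = e \<star> x\<close>.  For central \<open>e\<close> the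
  definition of the product reads \<open>2\<langle>e \<star> x, w\<rangle> = -\<langle>[x, w], e\<rangle>\<close>, so \<open>e\<close> is an
  eigenvector of the adjoint of \<open>ad\<^sub>x\<close> for the eigenvalue \<open>-2\<close>.  But \<open>ad\<^sub>x\<close> is nilpotent,
  hence \<open>e = 0\<close>, a contradiction (\<open>central_fixed_eq_0\<close>, \<open>isotropic_central_mult_eq_0\<close>).

  For the ideal property, \<open>Z + Z\<^sup>\<bottom> = (Z \<inter> Z\<^sup>\<bottom>)\<^sup>\<bottom>\<close> by non-degeneracy.  For
  \<open>e \<in> Z \<inter> Z\<^sup>\<bottom>\<close> one has \<open>\<langle>u \<star> v, e\<rangle> = -\<langle>v, u \<star> e\<rangle> = 0\<close>, so \<open>Z + Z\<^sup>\<bottom>\<close>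
  contains all products.
\<close>

section \<open>Isotropic subspaces and the signature\<close>

text \<open>
  Orthogonal projection onto the negative part is injective on a totally isotropic subspace,
  because a vector orthogonal to all negative directions has a sum of
  squares as its self-product, which vanishes only for the zero vector.
\<close>

lemma isotropic_card_le:
  fixes B :: "'a::real_vector \<Rightarrow> 'a \<Rightarrow> real"
  assumes bil: "bilinear B" and sig: "has_signature B p q"
    and indep: "independent T" and iso: "\<And>x y. x \<in> T \<Longrightarrow> y \<in> T \<Longrightarrow> B x y = 0"
  shows "finite T \<and> card T \<le> p"
proof -
  obtain N P where fin: "finite N" "finite P" and disj: "N \<inter> P = {}" and cN: "card N = p"
    and ind: "independent (N \<union> P)" and spn: "span (N \<union> P) = UNIV"
    and BN: "\<And>x. x \<in> N \<Longrightarrow> B x x = -1" and BP: "\<And>x. x \<in> P \<Longrightarrow> B x x = 1"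
    and orth: "\<And>x y. x \<in> N \<union> P \<Longrightarrow> y \<in> N \<union> P \<Longrightarrow> x \<noteq> y \<Longrightarrow> B x y = 0"
    using sig unfolding has_signature_def by metis
  have linB: "linear (B x)" "linear (\<lambda>y. B y x)" for x
    using bil by (auto simp: bilinear_def)
  define f where "f = (\<lambda>x. \<Sum>b\<in>N. B x b *\<^sub>R b)"
  have linf: "linear f"
    unfolding f_def
    by (intro linearI) (simp_all add: linear_add[OF linB(2)] linear_scale[OF linB(2)]
        scaleR_left_distrib sum.distrib scaleR_sum_right)
  have isoT: "B x y = 0" if "x \<in> span T" "y \<in> span T" for x y
  proof -
    have *: "B x t = 0" if "x \<in> span T" "t \<in> T" for x t
      using that(1) by (rule linear_eq_0_on_span[OF linB(2), rotated]) (use iso that in auto)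
    show ?thesis
      using that(2) by (rule linear_eq_0_on_span[OF linB(1), rotated]) (use * that in auto)
  qed
  have inj: "x = 0" if xT: "x \<in> span T" and fx: "f x = 0" for x
  proof -
    have indN: "independent N" by (rule independent_mono[OF ind]) simp
    have xN: "B x b = 0" if "b \<in> N" for b
      using independentD[OF indN fin(1) order_refl, of "B x"] fx that by (simp add: f_def)
    have "x \<in> span (N \<union> P)" using spn by simp
    then obtain c where c: "x = (\<Sum>b\<in>N \<union> P. c b *\<^sub>R b)"
      using span_finite[of "N \<union> P"] fin by (metis (no_types, lifting) finite_UnI rangeE)
    have coord: "B x b = c b * B b b" if b: "b \<in> N \<union> P" for b
    proof -
      have "B x b = (\<Sum>a\<in>N \<union> P. c a * B a b)"
        by (subst c) (simp add: linear_sum[OF linB(2)] linear_scale[OF linB(2)])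
      also have "\<dots> = (\<Sum>a\<in>N \<union> P. if a = b then c b * B b b else 0)"
        by (rule sum.cong) (simp_all add: orth[OF _ b])
      finally show ?thesis using fin b by simp
    qed
    have cN0: "c b = 0" if "b \<in> N" for b
      using coord[of b] xN[OF that] BN[OF that] that by simp
    have xP: "x = (\<Sum>b\<in>P. c b *\<^sub>R b)"
      unfolding c by (rule sum.mono_neutral_right) (use fin cN0 in auto)
    have "B x x = (\<Sum>b\<in>P. c b * B x b)"
      by (subst (2) xP) (simp add: linear_sum[OF linB(1)] linear_scale[OF linB(1)])
    also have "\<dots> = (\<Sum>b\<in>P. (c b)\<^sup>2)"
      by (rule sum.cong) (simp_all add: coord BP power2_eq_square)
    finally have "(\<Sum>b\<in>P. (c b)\<^sup>2) = 0" using isoT[OF xT xT] by simp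
    then have "\<forall>b\<in>P. c b = 0"
      using fin by (subst (asm) sum_nonneg_eq_0_iff) auto
    then show ?thesis using xP by simp
  qed
  have injT: "inj_on f (span T)"
    using inj by (simp add: linear_injective_on_subspace_0[OF linf subspace_span])
  have "independent (f ` T)"
    by (rule linear_independent_injective_image[OF linf indep injT])
  moreover have "f ` T \<subseteq> span N"
    unfolding f_def by (auto intro: span_sum span_scale span_base)
  ultimately have "finite (f ` T) \<and> card (f ` T) \<le> card N"
    using independent_span_bound[OF fin(1)] by blast
  moreover have "inj_on f T" by (rule inj_on_subset[OF injT span_superset])
  ultimately show ?thesis using cN by (simp add: finite_image_iff card_image)
qed

section \<open>Subspaces and orthogonals\<close>

lemma subspace_set_plus:
  fixes S T :: "'a::real_vector set"
  assumes "subspace S" "subspace T"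
  shows "subspace (S + T)"
proof -
  have "S + T = {x + y |x y. x \<in> S \<and> y \<in> T}" by (auto simp: set_plus_def)
  then show ?thesis using subspace_sums[OF assms] by simp
qed

lemma (in real_lie_algebra) subspace_lie_center: "subspace (lie_center br)"
  by (auto simp: subspace_def lie_center_def bilinear_ladd[OF bilinear_br]
      bilinear_lmul[OF bilinear_br] bilinear_lzero[OF bilinear_br])

context pseudo_euclidean_lie_algebra
begin

lemma subspace_form_perp: "subspace (form_perp B S)"
  by (auto simp: subspace_def form_perp_def bilinear_ladd[OF bilinear_form]
      bilinear_lmul[OF bilinear_form] bilinear_lzero[OF bilinear_form])

lemma form_perp_form_perp_subset:
  assumes W: "subspace W"
  shows "form_perp B (form_perp B W) \<subseteq> W"
proof (rule ccontr)
  assume "\<not> ?thesis"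
  then obtain x where x: "x \<in> form_perp B (form_perp B W)" "x \<notin> W" by blast
  obtain S where S: "S \<subseteq> W" "independent S" "W \<subseteq> span S"
    using maximal_independent_subset[of W] by blast
  then have spS: "span S = W" using W span_minimal by blast
  then have "independent (insert x S)" using S(2) x(2) by (simp add: independent_insertI)
  \<comment> \<open>A functional that vanishes on \<open>W\<close> but not at \<open>x\<close>, represented by the form.\<close>
  from linear_independent_extend[OF this, of "\<lambda>a. if a = x then 1 else 0"]
  obtain f :: "'a \<Rightarrow> real" where f: "linear f"
      "\<forall>a\<in>insert x S. f a = (if a = x then 1 else 0)"
    by metis
  obtain y where y: "\<And>w. B y w = f w" using form_represents[OF f(1)] by blast
  have "f w = 0" if "w \<in> W" for w
    by (rule linear_eq_0_on_span[OF f(1), of S]) (use f(2) S x that spS in auto)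
  then have "y \<in> form_perp B W" by (simp add: form_perp_def y)
  then have "f x = 0" using x(1) form_sym[of x y] by (simp add: form_perp_def y)
  then show False using f(2) by simp
qed

text \<open>
  Since \<open>(W + W\<^sup>\<bottom>)\<^sup>\<bottom> = W\<^sup>\<bottom> \<inter> W\<^sup>\<bottom>\<^sup>\<bottom> = W \<inter> W\<^sup>\<bottom>\<close>, this is the double
  orthogonal property of \<open>W + W\<^sup>\<bottom>\<close>.
\<close>

lemma form_perp_Int_perp_subset:
  assumes W: "subspace W"
  shows "form_perp B (W \<inter> form_perp B W) \<subseteq> W + form_perp B W"
proof -
  have sub: "W \<subseteq> W + form_perp B W" "form_perp B W \<subseteq> W + form_perp B W"
    using subspace_0[OF W] subspace_0[OF subspace_form_perp[of W]]
    by (force simp: set_plus_def)+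
  have sp: "subspace (W + form_perp B W)"
    by (rule subspace_set_plus[OF W subspace_form_perp])
  have "form_perp B (W + form_perp B W) \<subseteq> form_perp B (form_perp B W) \<inter> form_perp B W"
    using sub by (auto simp: form_perp_def)
  also have "\<dots> \<subseteq> W \<inter> form_perp B W" using form_perp_form_perp_subset[OF W] by blast
  finally have "form_perp B (W \<inter> form_perp B W) \<subseteq> form_perp B (form_perp B (W + form_perp B W))"
    by (auto simp: form_perp_def)
  also have "\<dots> \<subseteq> W + form_perp B W" by (rule form_perp_form_perp_subset[OF sp])
  finally show ?thesis .
qed

section \<open>The Levi-Civita product\<close>

abbreviation lc_product :: "'a \<Rightarrow> 'a \<Rightarrow> 'a" (infixl "\<star>" 70)
  where "u \<star> v \<equiv> levi_civita br B u v"

lemma br_antisym: "br x y = - br y x"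
proof -
  have "br (x + y) (x + y) = (br x x + br y x) + (br x y + br y y)"
    by (simp only: bilinear_ladd[OF bilinear_br] bilinear_radd[OF bilinear_br])
  then have "br x y + br y x = 0" by (simp add: br_self add.commute)
  then show ?thesis by (simp add: eq_neg_iff_add_eq_0)
qed

lemma lc_product_skew: "B (u \<star> v) w = - B v (u \<star> w)"
proof -
  have "2 * B (u \<star> v) w + 2 * B (u \<star> w) v = 0"
    unfolding levi_civita_eq
    using br_antisym[of v w] br_antisym[of v u] br_antisym[of w u]
    by (simp add: bilinear_lneg[OF bilinear_form])
  then show ?thesis using form_sym[of v "u \<star> w"] by simp
qed

lemma linear_lc_product: "linear (\<lambda>v. u \<star> v)"
proof (rule linearI)
  show "u \<star> (v + w) = u \<star> v + u \<star> w" for v w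
    by (rule form_eqI) (simp add: lc_product_skew bilinear_ladd[OF bilinear_form])
  show "u \<star> (c *\<^sub>R v) = c *\<^sub>R (u \<star> v)" for c v
    by (rule form_eqI) (simp add: lc_product_skew bilinear_lmul[OF bilinear_form])
qed

section \<open>Multiplication by a central element\<close>

lemma central_product_form:
  assumes z: "z \<in> lie_center br"
  shows "2 * B (z \<star> v) w = - B (br v w) z"
proof -
  have "br z v = 0" "br w z = 0" using z br_antisym[of w z] by (auto simp: lie_center_def)
  then show ?thesis
    using levi_civita_eq[of z v w] br_antisym[of w v]
    by (simp add: bilinear_lneg[OF bilinear_form] bilinear_lzero[OF bilinear_form])
qed

lemma central_product_commute:
  assumes z: "z \<in> lie_center br"
  shows "v \<star> z = z \<star> v"
proof (rule form_eqI)
  fix w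
  have "br v z = 0" "br w z = 0"
    using z br_antisym[of w z] br_antisym[of v z] by (auto simp: lie_center_def)
  then have "2 * B (v \<star> z) w = 2 * B (z \<star> v) w"
    using levi_civita_eq[of v z w] central_product_form[OF z, of v w] br_antisym[of w v]
    by (simp add: bilinear_lneg[OF bilinear_form] bilinear_lzero[OF bilinear_form])
  then show "B (v \<star> z) w = B (z \<star> v) w" by simp
qed

lemma central_product_self:
  assumes z: "z \<in> lie_center br"
  shows "z \<star> z = 0"
proof (rule form_eqI)
  fix w
  have "br z w = 0" using z by (simp add: lie_center_def)
  then show "B (z \<star> z) w = B 0 w"
    using central_product_form[OF z, of z w] by (simp add: bilinear_lzero[OF bilinear_form])
qed

text \<open>
  In left symmetry for \<open>(w, z, z)\<close>, the two terms on the right cancel because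
  \<open>w \<star> z = z \<star> w\<close> and \<open>L\<^sub>z = R\<^sub>z\<close>, the term \<open>w \<star> (z \<star> z)\<close> vanishes, and the remaining
  term \<open>(w \<star> z) \<star> z\<close> is \<open>L\<^sub>z\<^sup>2 w\<close>.
\<close>

lemma central_mult_square:
  assumes fl: "flat br B" and z: "z \<in> lie_center br"
  shows "z \<star> (z \<star> w) = 0"
proof -
  have "w \<star> z \<star> z - w \<star> (z \<star> z) = z \<star> w \<star> z - z \<star> (w \<star> z)"
    by (rule fl[unfolded flat_def left_symmetric_def, rule_format])
  then show ?thesis
    by (simp add: central_product_commute[OF z, of w] central_product_commute[OF z, of "z \<star> w"]
        central_product_self[OF z] linear_0[OF linear_lc_product])
qed

lemma funpow_br_in_lower_central_series: "(br x ^^ k) w \<in> lower_central_series br k"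
  by (induction k) (auto intro!: span_base)

text \<open>
  If \<open>e = e \<star> x\<close>, then \<open>\<langle>ad\<^sub>x w, e\<rangle> = -2\<langle>w, e\<rangle>\<close>, and iterating the nilpotent map
  \<open>ad\<^sub>x\<close> forces \<open>e\<close> into the radical of the form.
\<close>

lemma central_fixed_eq_0:
  assumes nil: "nilpotent_bracket br" and e: "e \<in> lie_center br" and fix_e: "e \<star> x = e"
  shows "e = 0"
proof (rule form_nondegenerate)
  fix w
  obtain k where k: "lower_central_series br k = {0}"
    using nil by (auto simp: nilpotent_bracket_def)
  have step: "B (br x w) e = -2 * B w e" for w
    using central_product_form[OF e, of x w] fix_e form_sym[of w e] by simp
  have "B ((br x ^^ j) w) e = (-2) ^ j * B w e" for j
    by (induction j) (simp_all add: step)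
  moreover have "(br x ^^ k) w = 0" using funpow_br_in_lower_central_series[of k x w] k by simp
  ultimately have "(-2) ^ k * B w e = 0" by (metis bilinear_lzero[OF bilinear_form])
  then show "B e w = 0" using form_sym[of w e] by simp
qed

text \<open>
  The only place where the signature enters: three independent, mutually orthogonal isotropic
  vectors \<open>e\<close>, \<open>e \<star> v\<close>, \<open>e \<star> w\<close> cannot exist, which puts \<open>e\<close> into the image of \<open>L\<^sub>e\<close>.
\<close>

lemma isotropic_central_mult_eq_0:
  assumes nil: "nilpotent_bracket br" and fl: "flat br B" and sig: "has_signature B 2 q"
    and e: "e \<in> lie_center br" and iso: "B e e = 0"
  shows "e \<star> v = 0"
proof (rule ccontr)
  assume nz: "e \<star> v \<noteq> 0"
  then obtain w where vw: "B (e \<star> v) w \<noteq> 0" using form_nondegenerate by blast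
  have self: "B (e \<star> u) u = 0" for u
    using lc_product_skew[of e u u] form_sym[of u "e \<star> u"] by simp
  have perp_e: "B (e \<star> u) e = 0" "B e (e \<star> u) = 0" for u
    using lc_product_skew[of e u e] lc_product_skew[of e e u] central_product_self[OF e]
    by (simp_all add: bilinear_lzero[OF bilinear_form] bilinear_rzero[OF bilinear_form]
        form_sym[of e "e \<star> u"])
  have img: "B (e \<star> u) (e \<star> u') = 0" for u u'
    using lc_product_skew[of e u "e \<star> u'"] central_mult_square[OF fl e, of u']
    by (simp add: bilinear_rzero[OF bilinear_form])
  \<comment> \<open>\<open>B _ w\<close> separates \<open>e \<star> v\<close> from the multiples of \<open>e \<star> w\<close>.\<close>
  have ev: "e \<star> v \<notin> span {e \<star> w}"
    using vw self[of w] by (auto simp: span_singleton bilinear_lmul[OF bilinear_form])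
  have "e \<star> w \<noteq> 0"
    using vw lc_product_skew[of e v w] by (auto simp: bilinear_rzero[OF bilinear_form])
  then have ind: "independent {e \<star> v, e \<star> w}"
    using ev by (intro independent_insertI) (auto simp: independent_empty)
  have ne: "e \<star> v \<noteq> e \<star> w" using ev span_base by force
  have "e \<in> span {e \<star> v, e \<star> w}"
  proof (rule ccontr)
    assume not_in: "e \<notin> span {e \<star> v, e \<star> w}"
    then have "independent {e, e \<star> v, e \<star> w}" using ind independent_insertI by blast
    moreover have "B x y = 0"
      if "x \<in> {e, e \<star> v, e \<star> w}" "y \<in> {e, e \<star> v, e \<star> w}" for x y
      using that by (elim insertE emptyE) (simp_all only: iso perp_e img)
    ultimately have "card {e, e \<star> v, e \<star> w} \<le> 2"
      using isotropic_card_le[OF bilinear_form sig] by blast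
    moreover have "e \<notin> {e \<star> v, e \<star> w}" using not_in span_base by metis
    ultimately show False using ne by simp
  qed
  also have "\<dots> \<subseteq> range (\<lambda>u. e \<star> u)"
    by (rule span_minimal[OF _ linear_subspace_image[OF linear_lc_product subspace_UNIV]]) simp
  finally obtain x where "e \<star> x = e" by (metis rangeE)
  then have "e = 0" by (rule central_fixed_eq_0[OF nil e])
  then have "B (br v w) e = 0" by (simp add: bilinear_rzero[OF bilinear_form])
  then show False using central_product_form[OF e, of v w] vw by simp
qed

end

section \<open>The degenerate part of the center\<close>

theorem theorem4p1:
  fixes br :: "'a::real_vector \<Rightarrow> 'a \<Rightarrow> 'a"
    and B :: "'a \<Rightarrow> 'a \<Rightarrow> real"
    and n :: nat
  assumes "pseudo_euclidean_lie_algebra br B"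
    and "nilpotent_bracket br"
    and "flat br B"
    and "n = dim (UNIV :: 'a set)"
    and "n \<ge> 2"
    and "has_signature B 2 (n - 2)"
  shows "(\<forall>e \<in> lie_center br \<inter> form_perp B (lie_center br).
            left_mult br B e = (\<lambda>v. 0) \<and> right_mult br B e = (\<lambda>v. 0))
       \<and> two_sided_ideal (levi_civita br B)
            (lie_center br + form_perp B (lie_center br))"
proof -
  interpret pseudo_euclidean_lie_algebra br B by fact
  let ?Z = "lie_center br"
  let ?I = "?Z + form_perp B ?Z"
  have left: "levi_civita br B e v = 0" if "e \<in> ?Z \<inter> form_perp B ?Z" for e v
    by (rule isotropic_central_mult_eq_0[OF assms(2,3,6)]) (use that in \<open>auto simp: form_perp_def\<close>)
  have right: "levi_civita br B v e = 0" if "e \<in> ?Z \<inter> form_perp B ?Z" for e v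
    using left[OF that, of v] central_product_commute[of e v] that by simp
  have "levi_civita br B u v \<in> form_perp B (?Z \<inter> form_perp B ?Z)" for u v
    by (auto simp: form_perp_def[of B "_ \<inter> _"] lc_product_skew right
        bilinear_rzero[OF bilinear_form])
  then have prods: "levi_civita br B u v \<in> ?I" for u v
    using form_perp_Int_perp_subset[OF subspace_lie_center] by blast
  have sub: "subspace ?I"
    by (rule subspace_set_plus[OF subspace_lie_center subspace_form_perp])
  have "two_sided_ideal (levi_civita br B) ?I"
    unfolding two_sided_ideal_def using sub prods by blast
  moreover have "left_mult br B e = (\<lambda>v. 0) \<and> right_mult br B e = (\<lambda>v. 0)"
    if "e \<in> ?Z \<inter> form_perp B ?Z" for e
    unfolding left_mult_def right_mult_def using left[OF that] right[OF that] by (simp add: fun_eq_iff)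
  ultimately show ?thesis by blast
qed

end
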